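(* Let $K$ be a locally compact homogeneous metric space. Let $P$ and $Q$ be Borel non-null locally finite non-negative measures on $K$ which are invariant under partial isometries defined on open sets of $K$. Then there is an $l>0$ such that $Q=lP$.
   Context: On a metric space $K$ define: $x\leftrightarrow y$ if and only if there are $\varepsilon>0$ and an isometry from the open ball $B(x;\varepsilon)$ onto the open ball $B(y;\varepsilon)$. $K$ is homogeneous if this equivalence relation has only one equivalence class. A partial isometry is an isometry $T$ from an open set $O$ of $K$ onto an open set of $K$ (not required to extend to $K$); a measure $P$ is invariant under $T$ if $P(T(A))=P(A)$ for every Borel set $A\subseteq O$.
   Formalization: P and Q are also assumed regular (outer on Borel sets, inner by compacts on open sets): automatic if K is separable; without it the claim fails on uncountable discrete K. The isometry of B(x;ε) onto B(y;ε) must map x to y. *)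

theory Defs
  imports "HOL-Analysis.Analysis"
begin

definition isometry_on :: "'a::metric_space set \<Rightarrow> ('a \<Rightarrow> 'a) \<Rightarrow> bool" where
  "isometry_on A T \<longleftrightarrow> (\<forall>x\<in>A. \<forall>y\<in>A. dist (T x) (T y) = dist x y)"

text \<open>The isometry between the two balls is required to map centre to centre.  Without this
  condition the relation is not transitive in general, and any two points of a bounded space
  would be related by the identity map.\<close>

definition locally_isometric :: "'a::metric_space \<Rightarrow> 'a \<Rightarrow> bool" where
  "locally_isometric x y \<longleftrightarrow>
     (\<exists>\<epsilon>>0. \<exists>T. isometry_on (ball x \<epsilon>) T \<and> T ` ball x \<epsilon> = ball y \<epsilon> \<and> T x = y)"

definition homogeneous_space :: "'a::metric_space itself \<Rightarrow> bool" where
  "homogeneous_space _ \<longleftrightarrow>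
     (\<exists>C. (UNIV :: 'a set) // {(x, y). locally_isometric x y} = {C})"

text \<open>Only the restriction of \<open>T\<close> to \<open>U\<close> matters: outside \<open>U\<close>, the total function \<open>T\<close> is
  arbitrary.\<close>

definition partial_isometry :: "'a::metric_space set \<Rightarrow> ('a \<Rightarrow> 'a) \<Rightarrow> bool" where
  "partial_isometry U T \<longleftrightarrow> open U \<and> open (T ` U) \<and> isometry_on U T"

definition isometry_invariant :: "'a::metric_space measure \<Rightarrow> bool" where
  "isometry_invariant P \<longleftrightarrow>
     (\<forall>U T. partial_isometry U T \<longrightarrow>
        (\<forall>A \<in> sets borel. A \<subseteq> U \<longrightarrow> emeasure P (T ` A) = emeasure P A))"

definition locally_finite_measure :: "'a::topological_space measure \<Rightarrow> bool" where
  "locally_finite_measure P \<longleftrightarrow> (\<forall>x. \<exists>U. open U \<and> x \<in> U \<and> emeasure P U < \<infinity>)"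

text \<open>Regularity in the sense usual for Radon measures on locally compact spaces.  By
  \<open>regular_measure_second_countable\<close> below, on separable spaces it is automatic for
  locally finite Borel measures.  On non-separable spaces it is not, and uniqueness fails without
  it: on an uncountable discrete space, the counting measure and the measure that is \<open>0\<close> on
  countable sets and \<open>\<infinity>\<close> on uncountable sets are both locally finite and invariant under all
  injections.\<close>

definition regular_measure :: "'a::topological_space measure \<Rightarrow> bool" where
  "regular_measure P \<longleftrightarrow>
     (\<forall>A \<in> sets borel. emeasure P A = (INF U\<in>{U. open U \<and> A \<subseteq> U}. emeasure P U)) \<and>
     (\<forall>U. open U \<longrightarrow> emeasure P U = (SUP C\<in>{C. compact C \<and> C \<subseteq> U}. emeasure P C))"

lemma isometry_on_image_ball:
  assumes T: "isometry_on (ball x e) T" "T ` ball x e = ball y e" "T x = y" and d: "d \<le> e" "0 < e"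
  shows "T ` ball x d = ball y d"
proof -
  have D: "dist y (T z) = dist x z" if "z \<in> ball x e" for z
    using T(1,3) that d(2) unfolding isometry_on_def by (metis centre_in_ball)
  show ?thesis
  proof (intro equalityI subsetI)
    fix w assume "w \<in> T ` ball x d"
    then show "w \<in> ball y d" using D d(1) by auto
  next
    fix w assume w: "w \<in> ball y d"
    then have "w \<in> T ` ball x e" using T(2) d(1) by auto
    then obtain z where z: "z \<in> ball x e" "w = T z" by auto
    then show "w \<in> T ` ball x d" using D w by auto
  qed
qed

lemma equiv_locally_isometric:
  "equiv (UNIV :: 'a::metric_space set) {(x, y). locally_isometric x y}"
proof (rule equivI)
  have "locally_isometric x x" for x :: 'a
    unfolding locally_isometric_def isometry_on_def
    by (intro exI[of _ 1] conjI exI[of _ "\<lambda>z. z"]) auto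
  then show "refl_on UNIV {(x, y :: 'a). locally_isometric x y}"
    by (auto simp: refl_on_def)
  have "locally_isometric y x" if "locally_isometric x y" for x y :: 'a
  proof -
    obtain e T where e: "e > 0" and T: "isometry_on (ball x e) T" "T ` ball x e = ball y e" "T x = y"
      using \<open>locally_isometric x y\<close> unfolding locally_isometric_def by blast
    have inj: "inj_on T (ball x e)"
      using T(1) unfolding isometry_on_def inj_on_def by (metis dist_eq_0_iff)
    let ?S = "the_inv_into (ball x e) T"
    have "isometry_on (ball y e) ?S"
      unfolding isometry_on_def T(2)[symmetric]
      using T(1) inj by (auto simp: isometry_on_def the_inv_into_f_f)
    moreover have "?S ` ball y e = ball x e"
      unfolding T(2)[symmetric] using inj by (rule the_inv_into_onto)
    moreover have "?S y = x"
      using inj T(3) e by (metis the_inv_into_f_f centre_in_ball)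
    ultimately show ?thesis using e unfolding locally_isometric_def by blast
  qed
  then show "sym {(x, y :: 'a). locally_isometric x y}" by (auto simp: sym_def)
  have "locally_isometric x z" if xy: "locally_isometric x y" and yz: "locally_isometric y z" for x y z :: 'a
  proof -
    obtain e T where e: "e > 0" and T: "isometry_on (ball x e) T" "T ` ball x e = ball y e" "T x = y"
      using xy unfolding locally_isometric_def by blast
    obtain d S where d: "d > 0" and S: "isometry_on (ball y d) S" "S ` ball y d = ball z d" "S y = z"
      using yz unfolding locally_isometric_def by blast
    define m where "m = min e d"
    have m: "m > 0" "m \<le> e" "m \<le> d" using e d by (auto simp: m_def)
    have Tm: "T ` ball x m = ball y m" using isometry_on_image_ball[OF T m(2) e] .
    have Sm: "S ` ball y m = ball z m" using isometry_on_image_ball[OF S m(3) d] .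
    have "isometry_on (ball x m) (S \<circ> T)"
      unfolding isometry_on_def
    proof (intro ballI)
      fix a b assume ab: "a \<in> ball x m" "b \<in> ball x m"
      then have "T a \<in> ball y m" "T b \<in> ball y m" using Tm by blast+
      then have "T a \<in> ball y d" "T b \<in> ball y d" "a \<in> ball x e" "b \<in> ball x e"
        using ab subset_ball[OF m(3), of y] subset_ball[OF m(2), of x] by blast+
      then show "dist ((S \<circ> T) a) ((S \<circ> T) b) = dist a b"
        using S(1) T(1) by (simp add: isometry_on_def)
    qed
    moreover have "(S \<circ> T) ` ball x m = ball z m" by (simp only: image_comp[symmetric] Tm Sm)
    moreover have "(S \<circ> T) x = z" using S T by simp
    ultimately show ?thesis using m unfolding locally_isometric_def by blast
  qed
  then show "trans {(x, y :: 'a). locally_isometric x y}" by (auto simp: trans_def)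
qed auto

lemma homogeneous_space_iff:
  "homogeneous_space TYPE('a::metric_space) \<longleftrightarrow> (\<forall>x y :: 'a. locally_isometric x y)"
proof
  assume "homogeneous_space TYPE('a)"
  then obtain C where C: "(UNIV :: 'a set) // {(x, y). locally_isometric x y} = {C}"
    unfolding homogeneous_space_def by blast
  have "{(x, y). locally_isometric x y} `` {x} = C" for x :: 'a
    using quotientI[OF UNIV_I, of "{(x, y). locally_isometric x y}" x] unfolding C by simp
  then have "(x, y) \<in> {(x, y :: 'a). locally_isometric x y}" for x y :: 'a
    using eq_equiv_class[OF _ equiv_locally_isometric UNIV_I] by metis
  then show "\<forall>x y :: 'a. locally_isometric x y" by simp
next
  assume "\<forall>x y :: 'a. locally_isometric x y"
  then have "{(x, y :: 'a). locally_isometric x y} = UNIV" by auto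
  then show "homogeneous_space TYPE('a)"
    unfolding homogeneous_space_def quotient_def by auto
qed

lemma borel_approx_open_closed:
  fixes P :: "'a::metric_space measure" and e :: real
  assumes sets: "sets P = sets borel" and V: "open V" "emeasure P V < \<infinity>"
    and A: "A \<in> sets borel" and e: "e > 0"
  shows "\<exists>U F. open U \<and> closed F \<and> F \<subseteq> A \<and> A \<subseteq> U \<and> emeasure P (V \<inter> (U - F)) \<le> ennreal e"
proof -
  have [measurable]: "open U \<Longrightarrow> U \<in> sets P" "closed F \<Longrightarrow> F \<in> sets P" for U F
    by (auto simp: sets)
  have fin: "emeasure P (V \<inter> B) \<noteq> \<infinity>" for B
    using V emeasure_mono[of "V \<inter> B" V P] by (auto simp: sets top_unique less_top)
  have "A \<in> sigma_sets UNIV (Collect closed)" using A by (simp add: borel_eq_closed)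
  then show ?thesis using e
  proof (induction arbitrary: e)
    case (Basic A)
    then have A: "closed A" by simp
    show ?case
    proof (cases "A = {}")
      case True
      then show ?thesis by (intro exI[of _ "{}"]) auto
    next
      case False
      define G where "G n = {x. infdist x A < 1 / real (Suc n)}" for n
      have oG: "open (G n)" for n
        unfolding G_def by (intro open_Collect_less continuous_intros)
      have AG: "A \<subseteq> G n" for n by (auto simp: G_def)
      have "(\<lambda>n. emeasure P (V \<inter> (G n - A))) \<longlonglongrightarrow> emeasure P (\<Inter>n. V \<inter> (G n - A))"
      proof (rule Lim_emeasure_decseq)
        show "range (\<lambda>n. V \<inter> (G n - A)) \<subseteq> sets P" using oG A V by auto
        have "G n \<subseteq> G m" if "m \<le> n" for m n
        proof
          fix x assume "x \<in> G n"
          moreover have "1 / real (Suc n) \<le> 1 / real (Suc m)" using that by (intro divide_left_mono) auto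
          ultimately show "x \<in> G m" by (simp add: G_def)
        qed
        then show "decseq (\<lambda>n. V \<inter> (G n - A))" unfolding decseq_def by blast
      qed (rule fin)
      moreover have "(\<Inter>n. V \<inter> (G n - A)) = {}"
      proof -
        have False if "x \<in> (\<Inter>n. V \<inter> (G n - A))" for x
        proof -
          have "infdist x A \<noteq> 0"
            using that in_closed_iff_infdist_zero[OF A False] by auto
          then have "infdist x A > 0" using infdist_nonneg[of x A] by simp
          then obtain n where "1 / real (Suc n) < infdist x A" by (rule nat_approx_posE)
          moreover have "x \<in> G n" using that by auto
          ultimately show False by (simp add: G_def)
        qed
        then show ?thesis by blast
      qed
      ultimately have "(\<lambda>n. emeasure P (V \<inter> (G n - A))) \<longlonglongrightarrow> 0" by simp
      then have "eventually (\<lambda>n. emeasure P (V \<inter> (G n - A)) < ennreal e) sequentially"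
        by (rule order_tendstoD) (use Basic.prems in simp)
      then obtain n where "emeasure P (V \<inter> (G n - A)) < ennreal e"
        by (auto simp: eventually_sequentially)
      then show ?thesis using oG AG A by (meson less_imp_le order_refl)
    qed
  next
    case Empty
    then show ?case by (intro exI[of _ "{}"]) auto
  next
    case (Compl A)
    then obtain U F where *: "open U" "closed F" "F \<subseteq> A" "A \<subseteq> U"
        "emeasure P (V \<inter> (U - F)) \<le> ennreal e" using Compl.IH[OF Compl.prems] by metis
    have "-F - -U = U - F" by auto
    then have "emeasure P (V \<inter> (-F - -U)) \<le> ennreal e" using *(5) by simp
    moreover have "open (-F)" "closed (-U)" "-U \<subseteq> UNIV - A" "UNIV - A \<subseteq> -F" using * by auto
    ultimately show ?case by metis
  next
    case (Union D)
    define c where "c n = e / 2 * (1 / 2) ^ Suc n" for n :: nat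
    have "\<forall>n. \<exists>U F. open U \<and> closed F \<and> F \<subseteq> D n \<and> D n \<subseteq> U \<and> emeasure P (V \<inter> (U - F)) \<le> ennreal (c n)"
      using Union.IH Union.prems by (simp add: c_def)
    then obtain U F where UF: "\<And>n. open (U n)" "\<And>n. closed (F n)" "\<And>n. F n \<subseteq> D n" "\<And>n. D n \<subseteq> U n"
        "\<And>n. emeasure P (V \<inter> (U n - F n)) \<le> ennreal (c n)" by metis
    define G where "G n = (\<Union>i<n. F i)" for n
    have clG: "closed (G n)" for n unfolding G_def using UF by auto
    have oU: "open (\<Union>n. U n)" using UF by auto
    have "(\<lambda>n. emeasure P (V \<inter> ((\<Union>n. U n) - G n))) \<longlonglongrightarrow> emeasure P (\<Inter>n. V \<inter> ((\<Union>n. U n) - G n))"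
    proof (rule Lim_emeasure_decseq)
      show "range (\<lambda>n. V \<inter> ((\<Union>n. U n) - G n)) \<subseteq> sets P" using oU clG V by auto
      have "G m \<subseteq> G n" if "m \<le> n" for m n
        unfolding G_def using that by (intro UN_mono) auto
      then show "decseq (\<lambda>n. V \<inter> ((\<Union>n. U n) - G n))" unfolding decseq_def by blast
    qed (rule fin)
    moreover have "emeasure P (\<Inter>n. V \<inter> ((\<Union>n. U n) - G n)) \<le> ennreal (e / 2)"
    proof -
      have "emeasure P (\<Inter>n. V \<inter> ((\<Union>n. U n) - G n)) \<le> emeasure P (\<Union>n. V \<inter> (U n - F n))"
      proof (rule emeasure_mono)
        show "(\<Inter>n. V \<inter> ((\<Union>n. U n) - G n)) \<subseteq> (\<Union>n. V \<inter> (U n - F n))"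
        proof
          fix x assume x: "x \<in> (\<Inter>n. V \<inter> ((\<Union>n. U n) - G n))"
          then obtain i where "x \<in> V" "x \<in> U i" by blast
          moreover have "x \<notin> G (Suc i)" using x by blast
          ultimately show "x \<in> (\<Union>n. V \<inter> (U n - F n))" by (auto simp: G_def)
        qed
      qed (use V UF in auto)
      also have "\<dots> \<le> (\<Sum>n. emeasure P (V \<inter> (U n - F n)))"
        using V UF by (intro emeasure_subadditive_countably) auto
      also have "\<dots> \<le> (\<Sum>n. ennreal (c n))" using UF by (intro suminf_le) auto
      also have "\<dots> = ennreal (e / 2)"
        using sums_mult[OF power_half_series, of "e / 2"] Union.prems
        by (intro suminf_ennreal_eq) (auto simp: c_def)
      finally show ?thesis .
    qed
    moreover have "ennreal (e / 2) < ennreal e" using Union.prems by (simp add: ennreal_less_iff)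
    ultimately have "eventually (\<lambda>n. emeasure P (V \<inter> ((\<Union>n. U n) - G n)) < ennreal e) sequentially"
      using order_tendstoD(2) order_le_less_trans by metis
    then obtain n where "emeasure P (V \<inter> ((\<Union>n. U n) - G n)) < ennreal e"
      by (auto simp: eventually_sequentially)
    moreover have "G n \<subseteq> (\<Union>n. D n)" "(\<Union>n. D n) \<subseteq> (\<Union>n. U n)"
      using UF(3,4) unfolding G_def by blast+
    ultimately show ?case using oU clG less_imp_le by metis
  qed
qed

lemma regular_measure_second_countable:
  fixes P :: "'a::{metric_space, second_countable_topology} measure"
  assumes lc: "locally compact (UNIV :: 'a set)"
    and sets: "sets P = sets borel" and lf: "locally_finite_measure P"
  shows "regular_measure P"
  unfolding regular_measure_def
proof (intro conjI ballI allI impI)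
  have [measurable]: "open U \<Longrightarrow> U \<in> sets P" "closed F \<Longrightarrow> F \<in> sets P" for U F
    by (auto simp: sets)
  fix A :: "'a set" assume A: "A \<in> sets borel"
  obtain \<F> where \<F>: "\<F> \<subseteq> {U. open U \<and> emeasure P U < \<infinity>}" "countable \<F>"
      "\<Union>\<F> = \<Union>{U. open U \<and> emeasure P U < \<infinity>}"
    using Lindelof[of "{U. open U \<and> emeasure P U < \<infinity>}"] by auto
  have U\<F>: "\<Union>\<F> = UNIV" using \<F>(3) lf unfolding locally_finite_measure_def by blast
  then have "\<F> \<noteq> {}" by auto
  define V where "V = from_nat_into \<F>"
  have V: "open (V n)" "emeasure P (V n) < \<infinity>" for n
    using from_nat_into[OF \<open>\<F> \<noteq> {}\<close>, of n] \<F>(1) by (auto simp: V_def)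
  have UV: "(\<Union>n. V n) = UNIV"
    using U\<F> range_from_nat_into[OF \<open>\<F> \<noteq> {}\<close> \<F>(2)] by (simp add: V_def)
  show "emeasure P A = (INF U\<in>{U. open U \<and> A \<subseteq> U}. emeasure P U)"
  proof (rule antisym)
    show "emeasure P A \<le> (INF U\<in>{U. open U \<and> A \<subseteq> U}. emeasure P U)"
      by (auto intro!: INF_greatest emeasure_mono)
    show "(INF U\<in>{U. open U \<and> A \<subseteq> U}. emeasure P U) \<le> emeasure P A"
    proof (rule ennreal_le_epsilon)
      fix e :: real assume e: "e > 0"
      define c where "c n = e * (1 / 2) ^ Suc n" for n :: nat
      have c: "c n > 0" for n using e by (simp add: c_def)
      have "\<forall>n. \<exists>U F. open U \<and> closed F \<and> F \<subseteq> A \<and> A \<subseteq> U \<and> emeasure P (V n \<inter> (U - F)) \<le> ennreal (c n)"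
        using borel_approx_open_closed[OF sets V A c] by blast
      then obtain U F where UF: "\<And>n. open (U n)" "\<And>n. closed (F n)" "\<And>n. F n \<subseteq> A" "\<And>n. A \<subseteq> U n"
        "\<And>n. emeasure P (V n \<inter> (U n - F n)) \<le> ennreal (c n)" by metis
      define W where "W = (\<Union>n. V n \<inter> U n)"
      have W: "open W" unfolding W_def using V(1) UF(1) by (intro open_UN ballI open_Int)
      have AW: "A \<subseteq> W"
      proof
        fix x assume x: "x \<in> A"
        obtain n where "x \<in> V n" using UV by blast
        then show "x \<in> W" using x UF(4) by (auto simp: W_def)
      qed
      have "(INF U\<in>{U. open U \<and> A \<subseteq> U}. emeasure P U) \<le> emeasure P W"
        using W AW by (intro INF_lower) auto
      also have "\<dots> \<le> emeasure P (A \<union> (\<Union>n. V n \<inter> (U n - F n)))"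
      proof (rule emeasure_mono)
        show "W \<subseteq> A \<union> (\<Union>n. V n \<inter> (U n - F n))" using UF(3) unfolding W_def by blast
      qed (use A UF V in \<open>auto simp: sets\<close>)
      also have "\<dots> \<le> emeasure P A + emeasure P (\<Union>n. V n \<inter> (U n - F n))"
        using A UF V by (intro emeasure_subadditive) (auto simp: sets)
      also have "emeasure P (\<Union>n. V n \<inter> (U n - F n)) \<le> (\<Sum>n. emeasure P (V n \<inter> (U n - F n)))"
        using V UF by (intro emeasure_subadditive_countably) auto
      also have "\<dots> \<le> (\<Sum>n. ennreal (c n))" using UF by (intro suminf_le) auto
      also have "\<dots> = ennreal e"
        using sums_mult[OF power_half_series, of e] e
        by (intro suminf_ennreal_eq) (auto simp: c_def)
      finally show "(INF U\<in>{U. open U \<and> A \<subseteq> U}. emeasure P U) \<le> emeasure P A + ennreal e"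
        by (simp add: add_left_mono)
    qed
  qed
next
  fix U :: "'a set" assume U: "open U"
  define \<G> where "\<G> = {W. open W \<and> (\<exists>C. compact C \<and> W \<subseteq> C \<and> C \<subseteq> U)}"
  have "U \<subseteq> \<Union>\<G>"
  proof
    fix x assume "x \<in> U"
    then obtain W C where "open W" "compact C" "x \<in> W" "W \<subseteq> C" "C \<subseteq> U"
      using lc U unfolding locally_def by (metis open_openin subtopology_UNIV)
    then show "x \<in> \<Union>\<G>" by (auto simp: \<G>_def)
  qed
  then have U\<G>: "\<Union>\<G> = U" by (auto simp: \<G>_def)
  obtain \<H> where \<H>: "\<H> \<subseteq> \<G>" "countable \<H>" "\<Union>\<H> = U"
    using Lindelof[of \<G>] U\<G> by (auto simp: \<G>_def)
  define \<K> where "\<K> = insert {} \<H>"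
  have \<K>: "\<K> \<noteq> {}" "countable \<K>" "\<Union>\<K> = U" using \<H> by (auto simp: \<K>_def)
  have "\<exists>C. compact C \<and> W \<subseteq> C \<and> C \<subseteq> U" if "W \<in> \<K>" for W
    using that \<H>(1) by (auto simp: \<K>_def \<G>_def)
  then obtain C where C: "\<And>W. W \<in> \<K> \<Longrightarrow> compact (C W) \<and> W \<subseteq> C W \<and> C W \<subseteq> U" by metis
  define K where "K n = (\<Union>i<n. C (from_nat_into \<K> i))" for n
  have K: "compact (K n)" "K n \<subseteq> U" for n
    using C from_nat_into[OF \<K>(1)] by (auto simp: K_def)
  have "(\<Union>n. K n) = U"
  proof (intro equalityI subsetI)
    fix x assume "x \<in> U"
    then obtain W where W: "W \<in> \<K>" "x \<in> W" using \<K>(3) by auto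
    then obtain i where "from_nat_into \<K> i = W" using from_nat_into_surj[OF \<K>(2)] by blast
    then have "x \<in> K (Suc i)" using W C by (auto simp: K_def)
    then show "x \<in> (\<Union>n. K n)" by auto
  qed (use K in auto)
  moreover have "(SUP n. emeasure P (K n)) = emeasure P (\<Union>n. K n)"
  proof (rule SUP_emeasure_incseq)
    show "range (\<lambda>n. K n) \<subseteq> sets P" using K by (auto simp: sets borel_compact)
    have "K m \<subseteq> K n" if "m \<le> n" for m n
      unfolding K_def using that by (intro UN_mono) auto
    then show "incseq (\<lambda>n. K n)" unfolding incseq_def by blast
  qed
  ultimately have eq: "emeasure P U = (SUP n. emeasure P (K n))" by simp
  show "emeasure P U = (SUP C\<in>{C. compact C \<and> C \<subseteq> U}. emeasure P C)"
  proof (rule antisym)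
    show "emeasure P U \<le> (SUP C\<in>{C. compact C \<and> C \<subseteq> U}. emeasure P C)"
      unfolding eq using K by (intro SUP_mono) auto
    show "(SUP C\<in>{C. compact C \<and> C \<subseteq> U}. emeasure P C) \<le> emeasure P U"
      using U by (auto intro!: SUP_least emeasure_mono simp: sets)
  qed
qed

end

theory Submission
  imports Defs
begin

text \<open>Invariance gives \<open>P (ball y r) = P (ball x r)\<close> and \<open>Q (ball y r) = Q (ball x r)\<close> for all small
  \<open>r\<close>, with a bound on \<open>r\<close> that depends on \<open>y\<close>. The points \<open>y\<close> for which the bound \<open>1 / n\<close> works form
  a closed set, so by Baire's theorem the bound is uniform on a nonempty open set \<open>W\<close>. On \<open>W\<close> the
  measures are uniformly distributed, and Christensen's argument applies: with \<open>h k\<close> and \<open>g k\<close> the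
  \<open>P\<close>- and \<open>Q\<close>-measures of balls of radius \<open>r k \<longlonglongrightarrow> 0\<close>, Fatou's lemma and Fubini's theorem for
  the set of pairs at distance less than \<open>r k\<close> give
  \<open>P U \<le> liminf (\<integral>\<^sup>+x\<in>U. Q (U \<inter> ball x (r k)) / g k \<partial>P) \<le> liminf (h k / g k) * Q U\<close>
  for open \<open>U \<subseteq> W\<close>. Exchanging \<open>P\<close> and \<open>Q\<close> along a subsequence where the ratio converges yields
  \<open>Q = c * P\<close> on \<open>W\<close>. Partial isometries carry this identity, with the same \<open>c\<close>, to a neighbourhood
  of every point, and regularity makes it global.\<close>

section \<open>Proportionality from open sets to Borel sets\<close>

text \<open>Multiplication by a positive finite \<open>c\<close> is an order isomorphism, inverted
  by multiplication by \<open>inverse c\<close>. The equation can fail for \<open>c = top\<close> if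
  positive values have infimum 0, and for \<open>c = 0\<close> if \<open>I\<close> is empty.\<close>

lemma ennreal_INF_cmult:
  fixes c :: ennreal
  assumes "c \<noteq> 0" "c \<noteq> top"
  shows "c * (INF i\<in>I. f i) = (INF i\<in>I. c * f i)"
proof (rule antisym)
  show "c * (INF i\<in>I. f i) \<le> (INF i\<in>I. c * f i)"
    by (auto intro!: INF_greatest mult_left_mono INF_lower)
  have inv: "c * inverse c = 1" "inverse c * c = 1"
    using ennreal_divide_self[of c] assms by (simp_all add: divide_ennreal_def less_top mult.commute)
  have c: "c * (inverse c * z) = z" "inverse c * (c * z) = z" for z
    by (simp_all add: mult.assoc[symmetric] inv)
  have "inverse c * (INF i\<in>I. c * f i) \<le> (INF i\<in>I. f i)"
  proof (rule INF_greatest)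
    fix i assume "i \<in> I"
    then have "inverse c * (INF i\<in>I. c * f i) \<le> inverse c * (c * f i)"
      by (intro mult_left_mono INF_lower) auto
    then show "inverse c * (INF i\<in>I. c * f i) \<le> f i" by (simp add: c)
  qed
  then have "c * (inverse c * (INF i\<in>I. c * f i)) \<le> c * (INF i\<in>I. f i)"
    by (rule mult_left_mono) simp
  then show "(INF i\<in>I. c * f i) \<le> c * (INF i\<in>I. f i)" by (simp add: c)
qed

text \<open>Intersecting an open superset of \<open>A\<close> with the open set \<open>W\<close>
  cannot increase its measure, so the infimum of outer regularity may be taken inside
  \<open>W\<close>, where \<open>eq\<close> applies.\<close>

lemma emeasure_proportional_borel:
  fixes P Q :: "'a::metric_space measure"
  assumes sets: "sets P = sets borel" "sets Q = sets borel"
    and reg: "regular_measure P" "regular_measure Q"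
    and c: "c \<noteq> 0" "c \<noteq> top"
    and W: "open W" and eq: "\<And>U. open U \<Longrightarrow> U \<subseteq> W \<Longrightarrow> emeasure Q U = c * emeasure P U"
    and A: "A \<in> sets borel" "A \<subseteq> W"
  shows "emeasure Q A = c * emeasure P A"
proof -
  let ?S = "{U. open U \<and> A \<subseteq> U \<and> U \<subseteq> W}"
  have inf: "emeasure R A = (INF U\<in>?S. emeasure R U)"
    if R: "sets R = sets borel" "regular_measure R" for R :: "'a measure"
  proof -
    have "(INF U\<in>{U. open U \<and> A \<subseteq> U}. emeasure R U) = (INF U\<in>?S. emeasure R U)"
    proof (rule INF_eq)
      fix U assume "U \<in> {U. open U \<and> A \<subseteq> U}"
      then show "\<exists>V\<in>?S. emeasure R V \<le> emeasure R U"
        using W A by (intro bexI[of _ "U \<inter> W"] emeasure_mono) (auto simp: R)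
    qed auto
    then show ?thesis using R A unfolding regular_measure_def by metis
  qed
  have "emeasure Q A = (INF U\<in>?S. c * emeasure P U)"
    unfolding inf[OF sets(2) reg(2)] using eq by (intro INF_cong) auto
  also have "\<dots> = c * emeasure P A"
    unfolding inf[OF sets(1) reg(1)] by (rule ennreal_INF_cmult[OF c, symmetric])
  finally show ?thesis .
qed

section \<open>Christensen's comparison of uniformly distributed measures\<close>

text \<open>\<open>D\<close> is the union over \<open>n\<close> of finite
  \<open>1 / Suc n\<close>-nets of \<open>C\<close>. This separability of compact sets stands in for
  second countability of the space.\<close>

lemma compact_countable_dense:
  fixes C :: "'a::metric_space set"
  assumes "compact C"
  obtains D where "countable D" "\<And>x e. x \<in> C \<Longrightarrow> e > 0 \<Longrightarrow> \<exists>q\<in>D. dist q x < e"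
proof -
  have "\<forall>n. \<exists>k. finite k \<and> C \<subseteq> (\<Union>x\<in>k. ball x (1 / real (Suc n)))"
    using seq_compact_imp_totally_bounded[OF compact_imp_seq_compact[OF assms]]
    by (metis of_nat_0_less_iff zero_less_Suc zero_less_divide_1_iff)
  then obtain k where k: "\<And>n. finite (k n)" "\<And>n. C \<subseteq> (\<Union>x\<in>k n. ball x (1 / real (Suc n)))"
    by metis
  show ?thesis
  proof
    show "countable (\<Union>n. k n)" using k(1) by (auto intro: countable_finite)
    fix x and e :: real assume x: "x \<in> C" and "e > 0"
    then obtain n where n: "1 / real (Suc n) < e" using nat_approx_posE by blast
    obtain q where "q \<in> k n" "x \<in> ball q (1 / real (Suc n))" using k(2)[of n] x by blast
    then show "\<exists>q\<in>(\<Union>n. k n). dist q x < e" using n by force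
  qed
qed

text \<open>The space is not assumed to be second countable, so that open sets of the product space need
  not belong to the product of the Borel algebras.\<close>

lemma near_diagonal_measurable:
  fixes M N :: "'a::metric_space measure"
  assumes C: "compact C" "U \<subseteq> C" and U: "open U"
    and M: "sets M = sets (restrict_space borel U)" "sets N = sets (restrict_space borel U)"
  shows "{(x, y). x \<in> U \<and> y \<in> U \<and> dist x y < r} \<in> sets (M \<Otimes>\<^sub>M N)"
proof -
  obtain D where D: "countable D" "\<And>x e. x \<in> C \<Longrightarrow> e > 0 \<Longrightarrow> \<exists>q\<in>D. dist q x < e"
    using compact_countable_dense[OF C(1)] by metis
  \<comment> \<open>The triangle inequality puts each rectangle inside the strip. Conversely, a pair
    \<open>(x, y)\<close> of the strip is caught once \<open>1 / Suc n\<close> is less than half the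
    slack \<open>r - dist x y\<close> and \<open>q\<close> is that close to
    \<open>x\<close>.\<close>
  let ?R = "\<lambda>q n. (U \<inter> ball q (1 / real (Suc n))) \<times> (U \<inter> ball q (r - 1 / real (Suc n)))"
  have "{(x, y). x \<in> U \<and> y \<in> U \<and> dist x y < r} = (\<Union>q\<in>D. \<Union>n. ?R q n)"
  proof (intro equalityI subsetI)
    fix p assume "p \<in> {(x, y). x \<in> U \<and> y \<in> U \<and> dist x y < r}"
    then obtain x y where p: "p = (x, y)" "x \<in> U" "y \<in> U" "dist x y < r" by auto
    then obtain n where n: "1 / real (Suc n) < (r - dist x y) / 2"
      using nat_approx_posE[of "(r - dist x y) / 2"] by auto
    obtain q where q: "q \<in> D" "dist q x < 1 / real (Suc n)"
      using D(2)[of x "1 / real (Suc n)"] p C by auto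
    have "dist q y < r - 1 / real (Suc n)"
      using n q(2) dist_triangle[of q y x] by argo
    then have "p \<in> ?R q n" using p q by simp
    then show "p \<in> (\<Union>q\<in>D. \<Union>n. ?R q n)" using q(1) by blast
  next
    fix p assume "p \<in> (\<Union>q\<in>D. \<Union>n. ?R q n)"
    then obtain q n where "p \<in> ?R q n" by blast
    moreover have "dist x y < r" if "dist q x < 1 / real (Suc n)" "dist q y < r - 1 / real (Suc n)" for x y
      using that dist_triangle[of x y q] by (simp add: dist_commute)
    ultimately show "p \<in> {(x, y). x \<in> U \<and> y \<in> U \<and> dist x y < r}" by auto
  qed
  moreover have "?R q n \<in> sets (M \<Otimes>\<^sub>M N)" for q n
    using U by (intro pair_measureI) (auto simp: M sets_restrict_space)
  ultimately show ?thesis using D(1) by auto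
qed

text \<open>Only one inequality is proved, so that the lemma can be applied again with
  \<open>P\<close> and \<open>Q\<close> exchanged. Positivity and finiteness are asked of
  \<open>g\<close> alone, since \<open>g k\<close> is the divisor; the compact set \<open>C\<close>
  makes the pairs at distance less than \<open>r k\<close> measurable.\<close>

lemma uniform_ball_measure_le:
  fixes P Q :: "'a::metric_space measure"
  assumes sets: "sets P = sets borel" "sets Q = sets borel"
    and U: "open U" "U \<subseteq> C" "compact C"
    and fin: "emeasure P U < \<infinity>" "emeasure Q U < \<infinity>"
    and r: "r \<longlonglongrightarrow> 0" "\<And>k. r k > 0"
    and h: "\<And>y k. y \<in> U \<Longrightarrow> emeasure P (ball y (r k)) = h k"
    and g: "\<And>x k. x \<in> U \<Longrightarrow> emeasure Q (ball x (r k)) = g k" "\<And>k. 0 < g k" "\<And>k. g k < \<infinity>"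
    and lim: "(\<lambda>k. h k / g k) \<longlonglongrightarrow> a"
  shows "emeasure P U \<le> a * emeasure Q U"
proof -
  \<comment> \<open>Restricting to \<open>U\<close> makes both measures finite, so that Fubini's
    theorem is available.\<close>
  define M where "M = restrict_space P U"
  define N where "N = restrict_space Q U"
  have [measurable]: "U \<in> sets P" "U \<in> sets Q" using U by (auto simp: sets)
  have sp: "space M = U" "space N = U"
    using sets_eq_imp_space_eq[OF sets(1)] sets_eq_imp_space_eq[OF sets(2)]
    by (auto simp: M_def N_def space_restrict_space)
  have emM: "emeasure M A = emeasure P A" and emN: "emeasure N A = emeasure Q A" if "A \<subseteq> U" for A
    using that by (auto simp: M_def N_def emeasure_restrict_space)
  have "finite_measure M" "finite_measure N"
    using fin by (auto intro!: finite_measureI simp: sp emM emN)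
  then interpret pair_sigma_finite M N
    by (simp add: pair_sigma_finite_def finite_measure_def)
  define S where "S k = {(x, y). x \<in> U \<and> y \<in> U \<and> dist x y < r k}" for k
  have S[measurable]: "S k \<in> sets (M \<Otimes>\<^sub>M N)" for k
    unfolding S_def using U
    by (intro near_diagonal_measurable[of C])
      (auto simp: M_def N_def sets intro!: sets_restrict_space_cong)
  define f where "f k x = emeasure N (Pair x -` S k) / g k" for k x
  have [measurable]: "f k \<in> borel_measurable M" for k
    unfolding f_def using M2.measurable_emeasure_Pair[OF S] by measurable
  have Sx: "Pair x -` S k = U \<inter> ball x (r k)" if "x \<in> U" for x k
    using that by (auto simp: S_def)
  have Sy: "(\<lambda>x. (x, y)) -` S k = U \<inter> ball y (r k)" if "y \<in> U" for y k
    using that by (auto simp: S_def dist_commute)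
  \<comment> \<open>Since \<open>U\<close> is open, \<open>ball x (r k)\<close> lies in
    \<open>U\<close> for all large \<open>k\<close>; from then on the numerator is exactly
    \<open>g k\<close>.\<close>
  have lim1: "liminf (\<lambda>k. f k x) = 1" if x: "x \<in> U" for x
  proof -
    obtain e where e: "e > 0" "ball x e \<subseteq> U" using x U(1) open_contains_ball by metis
    have "eventually (\<lambda>k. r k < e) sequentially" using r(1) e(1) by (rule order_tendstoD)
    then have "eventually (\<lambda>k. f k x = 1) sequentially"
    proof eventually_elim
      case (elim k)
      then have sub: "ball x (r k) \<subseteq> U" using e(2) by auto
      then have "Pair x -` S k = ball x (r k)" using Sx[OF x] by blast
      then have "f k x = g k / g k" using g(1)[OF x] emN[OF sub] by (simp add: f_def)
      then show ?case using g(2,3)[of k] by simp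
    qed
    then have "(\<lambda>k. f k x) \<longlonglongrightarrow> 1" by (rule tendsto_eventually)
    then show ?thesis by (intro lim_imp_Liminf) auto
  qed
  have int: "(\<integral>\<^sup>+x. f k x \<partial>M) \<le> emeasure Q U * (h k / g k)" for k
  proof -
    have "(\<integral>\<^sup>+x. f k x \<partial>M) = (\<integral>\<^sup>+x. emeasure N (Pair x -` S k) \<partial>M) / g k"
      unfolding f_def using M2.measurable_emeasure_Pair[OF S] by (intro nn_integral_divide)
    \<comment> \<open>Both integrals are the product measure of \<open>S k\<close>. After the
      exchange the sections are balls about \<open>y\<close> cut by \<open>U\<close>, with
      \<open>P\<close>-measure at most \<open>h k\<close>.\<close>
    also have "(\<integral>\<^sup>+x. emeasure N (Pair x -` S k) \<partial>M) = (\<integral>\<^sup>+y. emeasure M ((\<lambda>x. (x, y)) -` S k) \<partial>N)"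
      using M2.emeasure_pair_measure_alt[OF S] emeasure_pair_measure_alt2[OF S] by simp
    also have "\<dots> \<le> (\<integral>\<^sup>+y. h k \<partial>N)"
    proof (rule nn_integral_mono)
      fix y assume "y \<in> space N"
      then have y: "y \<in> U" by (simp add: sp)
      have "emeasure M ((\<lambda>x. (x, y)) -` S k) = emeasure P (U \<inter> ball y (r k))"
        by (simp add: Sy[OF y] emM)
      also have "\<dots> \<le> emeasure P (ball y (r k))" by (intro emeasure_mono) (auto simp: sets)
      finally show "emeasure M ((\<lambda>x. (x, y)) -` S k) \<le> h k" by (simp add: h[OF y])
    qed
    also have "\<dots> = h k * emeasure Q U" by (simp add: sp emN)
    finally show ?thesis
      by (simp add: divide_right_mono_ennreal ennreal_times_divide mult.commute)
  qed
  have "emeasure P U = (\<integral>\<^sup>+x. 1 \<partial>M)" by (simp add: sp emM)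
  also have "\<dots> = (\<integral>\<^sup>+x. liminf (\<lambda>k. f k x) \<partial>M)"
    using lim1 by (intro nn_integral_cong) (simp add: sp)
  also have "\<dots> \<le> liminf (\<lambda>k. \<integral>\<^sup>+x. f k x \<partial>M)" by (intro nn_integral_liminf) auto
  also have "\<dots> \<le> liminf (\<lambda>k. emeasure Q U * (h k / g k))"
    using int by (intro Liminf_mono) auto
  also have "\<dots> = emeasure Q U * a"
    using lim fin(2) by (intro lim_imp_Liminf ennreal_tendsto_cmult) auto
  finally show ?thesis by (simp add: mult.commute)
qed

text \<open>Along a subsequence \<open>g k / h k\<close> converges in the compact space
  \<open>ennreal\<close> to some \<open>a\<close>, and the reciprocals converge to
  \<open>inverse a\<close>. The comparison in both directions bounds \<open>Q\<close> by
  \<open>a * P\<close> and \<open>P\<close> by \<open>inverse a * Q\<close>.\<close>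

lemma uniform_ball_measures_proportional:
  fixes P Q :: "'a::metric_space measure"
  assumes sets: "sets P = sets borel" "sets Q = sets borel"
    and W: "open W" "W \<subseteq> C" "compact C"
    and fin: "emeasure P W < \<infinity>" "emeasure Q W < \<infinity>"
    and pos: "emeasure P W \<noteq> 0" "emeasure Q W \<noteq> 0"
    and r: "r \<longlonglongrightarrow> 0" "\<And>k. r k > 0"
    and h: "\<And>y k. y \<in> W \<Longrightarrow> emeasure P (ball y (r k)) = h k" "\<And>k. 0 < h k" "\<And>k. h k < \<infinity>"
    and g: "\<And>x k. x \<in> W \<Longrightarrow> emeasure Q (ball x (r k)) = g k" "\<And>k. 0 < g k" "\<And>k. g k < \<infinity>"
  obtains c where "c \<noteq> 0" "c \<noteq> top"
    "\<And>U. open U \<Longrightarrow> U \<subseteq> W \<Longrightarrow> emeasure Q U = c * emeasure P U"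
proof -
  obtain a s where s: "strict_mono s" and a: "((\<lambda>k. g k / h k) \<circ> s) \<longlonglongrightarrow> a"
    using compact_complete_linorder[of "\<lambda>k. g k / h k"] by blast
  have rs: "(\<lambda>k. r (s k)) \<longlonglongrightarrow> 0" using LIMSEQ_subseq_LIMSEQ[OF r(1) s] by (simp add: o_def)
  have gh: "(\<lambda>k. g (s k) / h (s k)) \<longlonglongrightarrow> a" using a by (simp add: o_def)
  have inv: "inverse (g k / h k) = h k / g k" for k
  proof -
    have "inverse (inverse (h k)) = h k"
      using h(2,3)[of k] by (cases "h k") (auto simp: inverse_ennreal)
    then show ?thesis
      using g(2,3)[of k] h(2,3)[of k]
      by (simp add: divide_ennreal_def ennreal_inverse_mult' mult.commute ennreal_inverse_positive)
  qed
  have "(\<lambda>k. inverse (g (s k) / h (s k))) \<longlonglongrightarrow> inverse a"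
    using gh continuous_on_inverse_ennreal[OF continuous_on_id, of UNIV]
    by (intro continuous_on_tendsto_compose[of UNIV inverse]) auto
  then have hg: "(\<lambda>k. h (s k) / g (s k)) \<longlonglongrightarrow> inverse a" by (simp add: inv)
  have fU: "emeasure P U < \<infinity>" "emeasure Q U < \<infinity>" if "open U" "U \<subseteq> W" for U
    using that W fin emeasure_mono[of U W P] emeasure_mono[of U W Q]
    by (auto simp: sets intro: le_less_trans)
  have QP: "emeasure Q U \<le> a * emeasure P U" if "open U" "U \<subseteq> W" for U
    using that W r g h
    by (intro uniform_ball_measure_le[OF sets(2,1) that(1) _ W(3) fU(2,1)[OF that] rs _ _ _ _ _ gh]) auto
  have PQ: "emeasure P U \<le> inverse a * emeasure Q U" if "open U" "U \<subseteq> W" for U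
    using that W r g h
    by (intro uniform_ball_measure_le[OF sets(1,2) that(1) _ W(3) fU(1,2)[OF that] rs _ _ _ _ _ hg]) auto
  \<comment> \<open>The limit could a priori be 0 or infinite; either would force \<open>Q\<close>
    or \<open>P\<close> to vanish on \<open>W\<close>.\<close>
  have a0: "a \<noteq> 0" using QP[OF W(1)] pos(2) by auto
  have a_top: "a \<noteq> top" using PQ[OF W(1)] pos(1) by auto
  have aa: "a * inverse a = 1"
    using ennreal_divide_self[of a] a0 a_top by (simp add: divide_ennreal_def less_top)
  show ?thesis
  proof (rule that[OF a0 a_top antisym[OF QP]])
    fix U assume U: "open U" "U \<subseteq> W"
    have "a * emeasure P U \<le> a * (inverse a * emeasure Q U)"
      by (intro mult_left_mono PQ U) simp
    then show "a * emeasure P U \<le> emeasure Q U" by (simp add: mult.assoc[symmetric] aa)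
  qed
qed

section \<open>Measures of balls as functions of the centre\<close>

text \<open>An open ball is the increasing union of smaller concentric balls, so continuity from
  below applies without any finiteness assumption.\<close>

lemma emeasure_ball_le_if_smaller_le:
  fixes P :: "'a::metric_space measure"
  assumes sets: "sets P = sets borel"
    and le: "\<And>s. 0 < s \<Longrightarrow> s < r \<Longrightarrow> emeasure P (ball x s) \<le> b"
  shows "emeasure P (ball x r) \<le> b"
proof (rule LIMSEQ_le_const2)
  have "ball x r = (\<Union>n. ball x (r - 1 / real (Suc n)))"
  proof (intro equalityI subsetI)
    fix y assume "y \<in> ball x r"
    then obtain n where "1 / real (Suc n) < r - dist x y"
      using nat_approx_posE[of "r - dist x y"] by auto
    then have "y \<in> ball x (r - 1 / real (Suc n))" by simp
    then show "y \<in> (\<Union>n. ball x (r - 1 / real (Suc n)))" by blast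
  next
    fix y assume "y \<in> (\<Union>n. ball x (r - 1 / real (Suc n)))"
    then obtain n where "dist x y < r - 1 / real (Suc n)" by auto
    moreover have "1 / real (Suc n) > 0" by simp
    ultimately have "dist x y < r" by linarith
    then show "y \<in> ball x r" by simp
  qed
  moreover have "1 / real (Suc n) \<le> 1 / real (Suc m)" if "m \<le> n" for m n
    using that by (intro divide_left_mono) auto
  then have "incseq (\<lambda>n. ball x (r - 1 / real (Suc n)))"
    unfolding incseq_def by (intro allI impI subset_ball) (auto simp: algebra_simps)
  ultimately show "(\<lambda>n. emeasure P (ball x (r - 1 / real (Suc n)))) \<longlonglongrightarrow> emeasure P (ball x r)"
    using Lim_emeasure_incseq[of "\<lambda>n. ball x (r - 1 / real (Suc n))" P]
    by (simp add: sets image_subset_iff)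
  have "emeasure P (ball x (r - 1 / real (Suc n))) \<le> b" for n
  proof (cases "r - 1 / real (Suc n) > 0")
    case True
    then show ?thesis by (rule le) simp
  next
    case False
    then have "ball x (r - 1 / real (Suc n)) = {}" by simp
    then show ?thesis by (simp only: emeasure_empty zero_le)
  qed
  then show "\<exists>N. \<forall>n\<ge>N. emeasure P (ball x (r - 1 / real (Suc n))) \<le> b" by blast
qed

text \<open>For \<open>s < r\<close> and a point \<open>z\<close> of the set with
  \<open>dist z y < r - s\<close>, the inclusions of \<open>ball y s\<close> in
  \<open>ball z r\<close> and of \<open>ball z s\<close> in \<open>ball y r\<close> compare the
  measures about \<open>y\<close> with those about \<open>x\<close>. Letting \<open>s\<close>
  increase to \<open>r\<close> gives equality.\<close>

lemma closed_uniform_balls: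
  fixes P :: "'a::metric_space measure"
  assumes sets: "sets P = sets borel"
  shows "closed {y. \<forall>r>0. r < d \<longrightarrow> emeasure P (ball y r) = emeasure P (ball x r)}"
    (is "closed ?E")
proof -
  have "y \<in> ?E" if "y \<in> closure ?E" for y
  proof -
    have app: "\<exists>z\<in>?E. dist z y < e" if "e > 0" for e
      using \<open>y \<in> closure ?E\<close> that by (auto simp: closure_approachable)
    have "emeasure P (ball y r) = emeasure P (ball x r)" if r: "r > 0" "r < d" for r
    proof (rule antisym; rule emeasure_ball_le_if_smaller_le[OF sets])
      fix s assume s: "0 < s" "s < r"
      obtain z where z: "z \<in> ?E" "dist z y < r - s" using app[of "r - s"] s by auto
      have sub: "ball y s \<subseteq> ball z r" "ball z s \<subseteq> ball y r"
        using z(2) dist_triangle[of z _ y] dist_triangle[of y _ z]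
        by (auto simp: subset_eq dist_commute) (smt (verit) dist_commute)+
      have "emeasure P (ball y s) \<le> emeasure P (ball z r)"
        using sub by (intro emeasure_mono) (auto simp: sets)
      then show "emeasure P (ball y s) \<le> emeasure P (ball x r)" using z r by simp
      have "emeasure P (ball z s) \<le> emeasure P (ball y r)"
        using sub by (intro emeasure_mono) (auto simp: sets)
      then show "emeasure P (ball x s) \<le> emeasure P (ball y r)" using z r s by simp
    qed
    then show ?thesis by blast
  qed
  then have "closure ?E \<subseteq> ?E" by blast
  then show ?thesis using closure_subset_eq by blast
qed

section \<open>Transport by partial isometries\<close>

text \<open>Because centres correspond, a single \<open>T\<close> serves all radii up to
  \<open>e\<close>.\<close>

lemma locally_isometricE:
  fixes x y :: "'a::metric_space"
  assumes "locally_isometric x y"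
  obtains e T where "e > 0"
    "\<And>r. r \<le> e \<Longrightarrow> partial_isometry (ball x r) T \<and> T ` ball x r = ball y r"
proof -
  obtain e T where e: "e > 0" and T: "isometry_on (ball x e) T" "T ` ball x e = ball y e" "T x = y"
    using assms unfolding locally_isometric_def by blast
  have "partial_isometry (ball x r) T \<and> T ` ball x r = ball y r" if "r \<le> e" for r
    using isometry_on_image_ball[OF T that e] T(1) subset_ball[OF that, of x]
    by (auto simp: partial_isometry_def isometry_on_def)
  then show ?thesis using e that by blast
qed

text \<open>The bound \<open>e\<close> comes from the geometry alone; with \<open>R\<close>
  quantified after it, \<open>P\<close> and \<open>Q\<close> share the same bound.\<close>

lemma emeasure_small_balls_eq:
  fixes x y :: "'a::metric_space"
  assumes "homogeneous_space TYPE('a)"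
  obtains e where "e > 0" "\<And>R r. isometry_invariant R \<Longrightarrow> r \<le> e \<Longrightarrow> emeasure R (ball y r) = emeasure R (ball x r)"
proof -
  obtain e T where e: "e > 0"
    "\<And>r. r \<le> e \<Longrightarrow> partial_isometry (ball x r) T \<and> T ` ball x r = ball y r"
    using assms locally_isometricE[of x y] unfolding homogeneous_space_iff by metis
  have "emeasure R (ball y r) = emeasure R (ball x r)" if R: "isometry_invariant R" and "r \<le> e" for R r
  proof -
    have "ball x r \<in> sets borel" by simp
    then have "emeasure R (T ` ball x r) = emeasure R (ball x r)"
      using R e(2)[OF \<open>r \<le> e\<close>] unfolding isometry_invariant_def by blast
    then show ?thesis using e(2)[OF \<open>r \<le> e\<close>] by simp
  qed
  then show ?thesis using e(1) that by blast
qed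

text \<open>Invariance replaces \<open>A\<close> by \<open>T\<close> A\<open>for both measures. This
  image is Borel, being the preimage
  of\<close>A\<open>under the inverse of\<close>T\<open>, which is continuous on the open set\<close>T
  \<open>V\<close>.\<close>

lemma emeasure_proportional_transport:
  fixes P Q :: "'a::metric_space measure"
  assumes inv: "isometry_invariant P" "isometry_invariant Q"
    and T: "partial_isometry V T"
    and eq: "\<And>A. A \<in> sets borel \<Longrightarrow> A \<subseteq> T ` V \<Longrightarrow> emeasure Q A = c * emeasure P A"
    and A: "A \<in> sets borel" "A \<subseteq> V"
  shows "emeasure Q A = c * emeasure P A"
proof -
  let ?S = "the_inv_into V T"
  have iso: "isometry_on V T" and op: "open V" "open (T ` V)"
    using T by (auto simp: partial_isometry_def)
  then have inj: "inj_on T V" unfolding isometry_on_def inj_on_def by (metis dist_eq_0_iff)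
  have "isometry_on (T ` V) ?S"
    unfolding isometry_on_def using iso inj by (auto simp: isometry_on_def the_inv_into_f_f)
  then have "continuous_on (T ` V) ?S"
    unfolding isometry_on_def continuous_on_iff by metis
  then have "?S \<in> borel_measurable (restrict_space borel (T ` V))"
    by (rule borel_measurable_continuous_on_restrict)
  from measurable_sets[OF this A(1)] have "?S -` A \<inter> T ` V \<in> sets borel"
    using op by (simp add: space_restrict_space sets_restrict_space_iff)
  moreover have "?S -` A \<inter> T ` V = T ` A"
    using A inj by (auto simp: the_inv_into_f_f subset_iff)
  ultimately have "emeasure Q (T ` A) = c * emeasure P (T ` A)"
    using eq[OF _ image_mono[OF A(2)]] by simp
  then show ?thesis using inv T A unfolding isometry_invariant_def by metis
qed

section \<open>From local to global proportionality\<close>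

lemma emeasure_proportional_finite_Union:
  fixes P Q :: "'a::topological_space measure"
  assumes sets: "sets P = sets borel" "sets Q = sets borel"
    and "finite F"
    and "\<And>N. N \<in> F \<Longrightarrow> open N"
    and "\<And>N A. N \<in> F \<Longrightarrow> A \<in> sets borel \<Longrightarrow> A \<subseteq> N \<Longrightarrow> emeasure Q A = c * emeasure P A"
    and "A \<in> sets borel" "A \<subseteq> \<Union>F"
  shows "emeasure Q A = c * emeasure P A"
  using assms(3-)
proof (induction F arbitrary: A rule: finite_induct)
  case empty
  then show ?case by simp
next
  case (insert N F)
  \<comment> \<open>The members of \<open>F\<close> may overlap; cutting \<open>A\<close> into its
    parts inside and outside \<open>N\<close> makes additivity applicable.\<close>
  have N: "A \<inter> N \<in> sets borel" "A - N \<in> sets borel" using insert.prems by auto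
  have "emeasure Q (A \<inter> N) = c * emeasure P (A \<inter> N)"
    using insert.prems(2)[of N "A \<inter> N"] N by blast
  moreover have "emeasure Q (A - N) = c * emeasure P (A - N)"
  proof (rule insert.IH)
    show "open N'" if "N' \<in> F" for N' using that insert.prems(1) by blast
    show "emeasure Q B = c * emeasure P B" if "N' \<in> F" "B \<in> sets borel" "B \<subseteq> N'" for N' B
      using that insert.prems(2)[of N' B] by blast
  qed (use N insert.prems(4) in auto)
  moreover have "emeasure R A = emeasure R (A \<inter> N) + emeasure R (A - N)"
    if "sets R = sets borel" for R
    using N plus_emeasure[of "A \<inter> N" R "A - N"] unfolding that Int_Diff_Un Int_Diff_disjoint by metis
  ultimately show ?case unfolding sets by (simp add: sets distrib_left)
qed

text \<open>Compact sets have finite covers by the given neighbourhoods; inner regularity then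
  extends the identity to open sets, and outer regularity to Borel sets.\<close>

lemma emeasure_proportional_global:
  fixes P Q :: "'a::metric_space measure"
  assumes sets: "sets P = sets borel" "sets Q = sets borel"
    and reg: "regular_measure P" "regular_measure Q"
    and c: "c \<noteq> 0" "c \<noteq> top"
    and loc: "\<And>x. \<exists>N. open N \<and> x \<in> N \<and> (\<forall>A\<in>sets borel. A \<subseteq> N \<longrightarrow> emeasure Q A = c * emeasure P A)"
    and A: "A \<in> sets borel"
  shows "emeasure Q A = c * emeasure P A"
proof (rule emeasure_proportional_borel[OF sets reg c open_UNIV _ A subset_UNIV])
  fix U :: "'a set" assume U: "open U"
  let ?\<N> = "{N. open N \<and> (\<forall>A\<in>sets borel. A \<subseteq> N \<longrightarrow> emeasure Q A = c * emeasure P A)}"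
  have K: "emeasure Q K = c * emeasure P K" if K: "compact K" for K
  proof -
    have "K \<subseteq> \<Union>?\<N>"
    proof
      fix x
      show "x \<in> \<Union>?\<N>" using loc[of x] by auto
    qed
    then obtain F where F: "F \<subseteq> ?\<N>" "finite F" "K \<subseteq> \<Union>F"
      by (rule compactE[OF K]) simp_all
    show ?thesis
    proof (rule emeasure_proportional_finite_Union[OF sets F(2) _ _ borel_compact[OF K] F(3)])
      fix N assume "N \<in> F"
      then have N: "N \<in> ?\<N>" using F(1) by blast
      then show "open N" by simp
      show "emeasure Q A = c * emeasure P A" if "A \<in> sets borel" "A \<subseteq> N" for A
        using N that by simp
    qed
  qed
  have "emeasure Q U = (SUP K\<in>{K. compact K \<and> K \<subseteq> U}. emeasure Q K)"
    using reg(2) U unfolding regular_measure_def by blast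
  also have "\<dots> = (SUP K\<in>{K. compact K \<and> K \<subseteq> U}. c * emeasure P K)"
    using K by (intro SUP_cong) auto
  also have "\<dots> = c * emeasure P U"
    using reg(1) U unfolding regular_measure_def SUP_mult_left_ennreal[symmetric] by metis
  finally show "emeasure Q U = c * emeasure P U" .
qed

section \<open>Positive and locally uniform ball measures\<close>

text \<open>A single null ball would give every point a null neighbourhood by homogeneity. Compact
  sets would then be null by finite covers, and the whole space by inner regularity.\<close>

lemma emeasure_ball_pos:
  fixes P :: "'a::metric_space measure"
  assumes hom: "homogeneous_space TYPE('a)"
    and sets: "sets P = sets borel" and nz: "emeasure P UNIV \<noteq> 0"
    and reg: "regular_measure P" and inv: "isometry_invariant P" and "r > 0"
  shows "emeasure P (ball x r) \<noteq> 0"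
proof
  assume z: "emeasure P (ball x r) = 0"
  have null: "\<exists>N. open N \<and> y \<in> N \<and> N \<in> null_sets P" for y
  proof -
    obtain e where e: "e > 0"
      "\<And>R r. isometry_invariant R \<Longrightarrow> r \<le> e \<Longrightarrow> emeasure R (ball y r) = emeasure R (ball x r)"
      using emeasure_small_balls_eq[OF hom, of y x] by blast
    have "emeasure P (ball y (min e r)) = emeasure P (ball x (min e r))"
      by (rule e(2)[OF inv]) simp
    also have "\<dots> \<le> emeasure P (ball x r)" by (intro emeasure_mono) (auto simp: sets)
    finally show ?thesis
      using z e(1) \<open>r > 0\<close> by (intro exI[of _ "ball y (min e r)"]) (auto simp: sets)
  qed
  have "emeasure P K = 0" if K: "compact K" for K
  proof -
    obtain F where F: "F \<subseteq> {N. open N \<and> N \<in> null_sets P}" "finite F" "K \<subseteq> \<Union>F"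
      by (rule compactE[OF K, of "{N. open N \<and> N \<in> null_sets P}"]) (use null in blast)+
    have "\<Union>F \<in> null_sets P" using F null_sets_UN'[of F "\<lambda>N. N" P] by (auto intro: countable_finite)
    moreover have "K \<in> sets P" using K by (simp add: sets borel_compact)
    ultimately have "K \<in> null_sets P" using F(3) by (rule null_sets_subset)
    then show ?thesis by auto
  qed
  then have "(SUP K\<in>{K. compact K \<and> K \<subseteq> UNIV}. emeasure P K) \<le> 0"
    by (intro SUP_least) auto
  moreover have "emeasure P UNIV = (SUP K\<in>{K. compact K \<and> K \<subseteq> UNIV}. emeasure P K)"
    using reg unfolding regular_measure_def by blast
  ultimately show False using nz by (metis le_zero_eq)
qed

lemma homogeneous_uniform_balls:
  fixes P Q :: "'a::metric_space measure"
  assumes lc: "locally compact (UNIV :: 'a set)" and hom: "homogeneous_space TYPE('a)"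
    and sets: "sets P = sets borel" "sets Q = sets borel"
    and inv: "isometry_invariant P" "isometry_invariant Q"
  obtains V d where "open V" "V \<noteq> {}" "d > 0"
    "\<And>y z r. y \<in> V \<Longrightarrow> z \<in> V \<Longrightarrow> 0 < r \<Longrightarrow> r < d \<Longrightarrow> emeasure P (ball y r) = emeasure P (ball z r)"
    "\<And>y z r. y \<in> V \<Longrightarrow> z \<in> V \<Longrightarrow> 0 < r \<Longrightarrow> r < d \<Longrightarrow> emeasure Q (ball y r) = emeasure Q (ball z r)"
proof -
  fix x :: 'a
  \<comment> \<open>Requiring both conditions in the same \<open>E n\<close> lets one application of
    Baire's theorem produce a common \<open>V\<close> and \<open>d\<close>. The reference point
    \<open>x\<close> is arbitrary.\<close>
  define E where "E n = {y. \<forall>r>0. r < 1 / real (Suc n) \<longrightarrow> emeasure P (ball y r) = emeasure P (ball x r)}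
    \<inter> {y. \<forall>r>0. r < 1 / real (Suc n) \<longrightarrow> emeasure Q (ball y r) = emeasure Q (ball x r)}" for n
  have cl: "closed (E n)" for n
    unfolding E_def by (intro closed_Int closed_uniform_balls sets)
  have "y \<in> (\<Union>n. E n)" for y
  proof -
    obtain e where e: "e > 0"
      "\<And>R r. isometry_invariant R \<Longrightarrow> r \<le> e \<Longrightarrow> emeasure R (ball y r) = emeasure R (ball x r)"
      using emeasure_small_balls_eq[OF hom, of y x] by blast
    obtain n where n: "1 / real (Suc n) < e" using e(1) nat_approx_posE by blast
    have "emeasure P (ball y r) = emeasure P (ball x r)" "emeasure Q (ball y r) = emeasure Q (ball x r)"
      if "r < 1 / real (Suc n)" for r
      using e(2) inv that n by auto
    then have "y \<in> E n" by (simp add: E_def)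
    then show ?thesis by blast
  qed
  then have UE: "(\<Union>n. E n) = UNIV" by blast
  have "\<exists>U K. open U \<and> compact K \<and> y \<in> U \<and> U \<subseteq> K" for y :: 'a
    using lc unfolding locally_def by (metis UNIV_I open_UNIV open_openin subtopology_UNIV)
  \<comment> \<open>The metric need not be complete, so Baire's theorem is applied in its version
    for locally compact regular spaces.\<close>
  then have "locally_compact_space (euclidean :: 'a topology)"
    unfolding locally_compact_space_def by simp
  moreover have "regular_space (euclidean :: 'a topology)"
    using Met_TC.metrizable_space_mtopology metrizable_imp_regular_space
    by (metis mtopology_is_euclidean)
  ultimately obtain n where n: "interior (E n) \<noteq> {}"
    using Baire_category_alt[of "euclidean :: 'a topology" "range E"] cl UE by auto
  have ball_eq: "emeasure P (ball y r) = emeasure P (ball x r) \<and> emeasure Q (ball y r) = emeasure Q (ball x r)"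
    if "y \<in> interior (E n)" "0 < r" "r < 1 / real (Suc n)" for y r
    using subsetD[OF interior_subset that(1)] that(2,3) by (simp add: E_def)
  show ?thesis
  proof (rule that[OF open_interior n, of "1 / real (Suc n)"])
    fix y z r assume "y \<in> interior (E n)" "z \<in> interior (E n)" "0 < r" "r < 1 / real (Suc n)"
    then show "emeasure P (ball y r) = emeasure P (ball z r)" "emeasure Q (ball y r) = emeasure Q (ball z r)"
      by (simp_all only: ball_eq)
  qed simp
qed

section \<open>Localization at a point and determination of the constant\<close>

theorem theorem15:
  fixes P Q :: "'a::metric_space measure"
  assumes "locally compact (UNIV :: 'a set)"
    and "homogeneous_space TYPE('a)"
    and "sets P = sets borel" and "sets Q = sets borel"
    and "emeasure P UNIV \<noteq> 0" and "emeasure Q UNIV \<noteq> 0"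
    and "locally_finite_measure P" and "locally_finite_measure Q"
    and "regular_measure P" and "regular_measure Q"
    and "isometry_invariant P" and "isometry_invariant Q"
  shows "\<exists>l::real. l > 0 \<and> Q = scale_measure (ennreal l) P"
proof -
  note sets = assms(3,4) and reg = assms(9,10) and inv = assms(11,12)
  obtain V d where V: "open V" "V \<noteq> {}" "d > 0"
    and VP: "\<And>y z r. y \<in> V \<Longrightarrow> z \<in> V \<Longrightarrow> 0 < r \<Longrightarrow> r < d \<Longrightarrow> emeasure P (ball y r) = emeasure P (ball z r)"
    and VQ: "\<And>y z r. y \<in> V \<Longrightarrow> z \<in> V \<Longrightarrow> 0 < r \<Longrightarrow> r < d \<Longrightarrow> emeasure Q (ball y r) = emeasure Q (ball z r)"
    by (rule homogeneous_uniform_balls[OF assms(1,2) sets inv]) (rule that)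
  obtain w where w: "w \<in> V" using V(2) by blast
  obtain U C where UC: "open U" "compact C" "w \<in> U" "U \<subseteq> C"
    using assms(1) unfolding locally_def by (metis UNIV_I open_UNIV open_openin subtopology_UNIV)
  obtain U1 U2 where U12: "open U1" "w \<in> U1" "emeasure P U1 < \<infinity>" "open U2" "w \<in> U2" "emeasure Q U2 < \<infinity>"
    using assms(7,8) unfolding locally_finite_measure_def by metis
  \<comment> \<open>On \<open>W\<close> ball measures are uniform (\<open>V\<close>), pairs are
    measurable (\<open>U\<close> lies in the compact \<open>C\<close>), and both measures are finite
    (\<open>U1\<close>, \<open>U2\<close>).\<close>
  define W where "W = V \<inter> U \<inter> U1 \<inter> U2"
  have W: "open W" "W \<subseteq> C" "w \<in> W" "W \<subseteq> V"
    using V UC U12 w by (auto simp: W_def)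
  have fin: "emeasure P W < \<infinity>" "emeasure Q W < \<infinity>"
    using emeasure_mono[of W U1 P] emeasure_mono[of W U2 Q] U12
    by (auto simp: W_def sets intro: le_less_trans)
  obtain e where e: "e > 0" "ball w e \<subseteq> W" using W open_contains_ball by metis
  define m where "m = min e d"
  have m: "m > 0" "m \<le> e" "m \<le> d" using e V by (auto simp: m_def)
  \<comment> \<open>The shift by 2 makes \<open>r k < m\<close> strict even at \<open>k = 0\<close>:
    radii must stay below \<open>d\<close> for uniformity, and below \<open>e\<close> for
    \<open>ball w (r k)\<close> to have finite measure.\<close>
  define r :: "nat \<Rightarrow> real" where "r k = m / real (k + 2)" for k
  have r: "r k > 0" "r k < m" for k
  proof -
    have "m * 1 < m * real (k + 2)" using m by (intro mult_strict_left_mono) auto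
    then show "r k > 0" "r k < m" using m by (simp_all add: r_def pos_divide_less_eq)
  qed
  have r0: "r \<longlonglongrightarrow> 0"
    unfolding r_def[abs_def] using lim_const_over_n by (rule LIMSEQ_ignore_initial_segment)
  have re: "r k < e" "r k < d" for k using r[of k] m by auto
  note ball_pos = emeasure_ball_pos[OF assms(2) sets(1) assms(5) reg(1) inv(1)]
    emeasure_ball_pos[OF assms(2) sets(2) assms(6) reg(2) inv(2)]
  have le: "emeasure R (ball w s) \<le> emeasure R W" if "sets R = sets borel" "s \<le> e" for R s
    using that e(2) W(1) subset_ball[of s e w] by (intro emeasure_mono) auto
  have rW: "emeasure P (ball w (r k)) < \<infinity>" "emeasure Q (ball w (r k)) < \<infinity>" for k
    using le[OF sets(1), of "r k"] le[OF sets(2), of "r k"] re[of k] fin by (auto intro: le_less_trans)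
  have pos: "emeasure P W \<noteq> 0" "emeasure Q W \<noteq> 0"
    using le[OF sets(1) order_refl] le[OF sets(2) order_refl] ball_pos[OF e(1), of w] by auto
  obtain c where c: "c \<noteq> 0" "c \<noteq> top"
    and open_prop: "\<And>U. open U \<Longrightarrow> U \<subseteq> W \<Longrightarrow> emeasure Q U = c * emeasure P U"
  proof (rule uniform_ball_measures_proportional[OF sets W(1,2) UC(2) fin pos r0 r(1)])
    show "emeasure P (ball y (r k)) = emeasure P (ball w (r k))"
      "emeasure Q (ball y (r k)) = emeasure Q (ball w (r k))" if "y \<in> W" for y k
      using W w r(1) re(2) VP[of y w "r k"] VQ[of y w "r k"] that by auto
  qed (use rW r(1) ball_pos in \<open>auto simp: zero_less_iff_neq_zero\<close>)
  have W_prop: "emeasure Q A = c * emeasure P A" if "A \<in> sets borel" "A \<subseteq> W" for A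
    using emeasure_proportional_borel[OF sets reg c W(1) open_prop that] .
  have all: "emeasure Q A = c * emeasure P A" if "A \<in> sets borel" for A
  proof (rule emeasure_proportional_global[OF sets reg c _ that])
    fix x
    \<comment> \<open>A small ball about \<open>x\<close> is carried to a ball about
      \<open>w\<close> inside \<open>W\<close>, so the constant is the same \<open>c\<close> at
      every point.\<close>
    obtain s T where s: "s > 0"
      "\<And>r. r \<le> s \<Longrightarrow> partial_isometry (ball x r) T \<and> T ` ball x r = ball w r"
      using assms(2) locally_isometricE[of x w] unfolding homogeneous_space_iff by metis
    have T: "partial_isometry (ball x (min s e)) T" "T ` ball x (min s e) \<subseteq> W"
      using s(2)[of "min s e"] e(2) subset_ball[of "min s e" e w] by auto
    then show "\<exists>N. open N \<and> x \<in> N \<and> (\<forall>A\<in>sets borel. A \<subseteq> N \<longrightarrow> emeasure Q A = c * emeasure P A)"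
      using emeasure_proportional_transport[OF inv T(1), of c] W_prop s(1) e(1)
      by (intro exI[of _ "ball x (min s e)"]) auto
  qed
  obtain l where l: "c = ennreal l" "l > 0"
    using c by (cases c) (auto simp: order_le_less)
  have "Q = scale_measure (ennreal l) P"
    by (rule measure_eqI) (auto simp: sets all l)
  then show ?thesis using l by blast
qed

end
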